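(* Let $\hat G=(X,w,\deg)$ and $\hat G'=(X',w',\deg')$ be normalized graphs and let $\phi:X\to\phi(X)\subseteq X'$ be a bijection onto its image. Then $\hat G\hookrightarrow_\phi\hat G'$ if and only if $$\frac{w(x_i,x_j)}{\deg(x_i)}=\frac{w_\phi(\phi(x_i),\phi(x_j))}{\deg_\phi(\phi(x_i))}\qquad\text{for all }x_i,x_j\in X. \quad ( * )$$ In particular, condition $( * )$ is equivalent to $$\frac{w(x_i,x_j)}{w(x_i,x_k)}=\frac{w'(\phi(x_i),\phi(x_j))}{w'(\phi(x_i),\phi(x_k))}\qquad\text{for all }x_i,x_j,x_k\in X\text{ such that }x_j\sim x_i\text{ and }x_k\sim x_i\text{ in }\hat G.$$ (Each of the two displayed conditions is understood to include the requirement that the denominators occurring in it are nonzero.)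
   Context: **Graphs.** A graph is a triple $G=(X,w,\mu)$ where $X$ is a finite node set with at least two nodes, $w:X\times X\to[0,\infty)$ is symmetric with $w(x,x)=0$ for all $x$, and $\mu:X\to(0,\infty)$. A pair $\{x,y\}$ is an edge (written $x\sim y$) iff $w(x,y)>0$. All graphs are assumed connected. The degree is $\deg(x)=\sum_{y\in X}w(x,y)$ (positive by connectedness). A normalized graph is one with $\mu=\deg$. The graph Laplacian of $(X,w,\mu)$ is $\Delta[u](x)=\frac1{\mu(x)}\sum_{y\in X}w(x,y)(u(x)-u(y))$ for $u:X\to\mathbb R$. **$\phi$-induced subgraph.** For a bijection $\phi:X\to\phi(X)\subseteq X'$, put $w_\phi(x',y')=w'(x',y')$ if $x',y'\in\phi(X)$ and $\{\phi^{-1}(x'),\phi^{-1}(y')\}$ is an edge of $\hat G$, $w_\phi(x',y')=0$ for the other $x',y'\in\phi(X)$, and $\deg_\phi(x')=\sum_{y'\in\phi(X)}w_\phi(x',y')$. If $\phi$ satisfies (E1): for every edge $\{x,y\}$ of $\hat G$, $\{\phi(x),\phi(y)\}$ is an edge of $\hat G'$, then the $\phi$-induced subgraph of $\hat G'$ is $\phi(\hat G)=(\phi(X),w_\phi,\deg_\phi)$. **Embedding.** $\hat G\hookrightarrow_\phi\hat G'$ means: $\phi$ satisfies (E1), and for every $u:X\to\mathbb R$ and $x\in X$, $\hat\Delta[u](x)=\hat\Delta_{\phi(\hat G)}[u\circ\phi^{-1}](\phi(x))$, where $\hat\Delta$ is the graph Laplacian of $\hat G$ and $\hat\Delta_{\phi(\hat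 G)}$ that of $\phi(\hat G)$. *)

theory Defs
  imports Complex_Main
begin

text \<open>
  Weighted graphs \<open>(X, w, \<mu>)\<close> on a carrier set \<open>X\<close>. The functions \<open>weight\<close> and \<open>vmeasure\<close> are total
  in HOL; only their values on the nodes are constrained or used.
\<close>

record 'a wgraph =
  nodes :: "'a set"
  weight :: "'a \<Rightarrow> 'a \<Rightarrow> real"
  vmeasure :: "'a \<Rightarrow> real"

definition adj :: "'a wgraph \<Rightarrow> 'a \<Rightarrow> 'a \<Rightarrow> bool" where
  "adj G x y \<longleftrightarrow> x \<in> nodes G \<and> y \<in> nodes G \<and> weight G x y > 0"

definition connected_wgraph :: "'a wgraph \<Rightarrow> bool" where
  "connected_wgraph G \<longleftrightarrow> (\<forall>x\<in>nodes G. \<forall>y\<in>nodes G. (adj G)\<^sup>*\<^sup>* x y)"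

definition is_wgraph :: "'a wgraph \<Rightarrow> bool" where
  "is_wgraph G \<longleftrightarrow>
     finite (nodes G) \<and> card (nodes G) \<ge> 2 \<and>
     (\<forall>x\<in>nodes G. \<forall>y\<in>nodes G. weight G x y \<ge> 0) \<and>
     (\<forall>x\<in>nodes G. \<forall>y\<in>nodes G. weight G x y = weight G y x) \<and>
     (\<forall>x\<in>nodes G. weight G x x = 0) \<and>
     (\<forall>x\<in>nodes G. vmeasure G x > 0) \<and>
     connected_wgraph G"

definition degree :: "'a wgraph \<Rightarrow> 'a \<Rightarrow> real" where
  "degree G x = (\<Sum>y\<in>nodes G. weight G x y)"

definition normalized_wgraph :: "'a wgraph \<Rightarrow> bool" where
  "normalized_wgraph G \<longleftrightarrow> is_wgraph G \<and> (\<forall>x\<in>nodes G. vmeasure G x = degree G x)"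

definition laplacian :: "'a wgraph \<Rightarrow> ('a \<Rightarrow> real) \<Rightarrow> 'a \<Rightarrow> real" where
  "laplacian G u x = (1 / vmeasure G x) * (\<Sum>y\<in>nodes G. weight G x y * (u x - u y))"

text \<open>
  In the following, \<open>\<phi>\<close> is injective on \<open>nodes G\<close> and \<open>inv_into (nodes G) \<phi>\<close> is its inverse on the image.
  The weight \<open>w\<^sub>\<phi>\<close> is extended by \<open>0\<close> outside the image.
\<close>

definition w_ind :: "'a wgraph \<Rightarrow> 'b wgraph \<Rightarrow> ('a \<Rightarrow> 'b) \<Rightarrow> 'b \<Rightarrow> 'b \<Rightarrow> real" where
  "w_ind G G' \<phi> x' y' =
     (if x' \<in> \<phi> ` nodes G \<and> y' \<in> \<phi> ` nodes G \<and>
         adj G (inv_into (nodes G) \<phi> x') (inv_into (nodes G) \<phi> y')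
      then weight G' x' y' else 0)"

definition deg_ind :: "'a wgraph \<Rightarrow> 'b wgraph \<Rightarrow> ('a \<Rightarrow> 'b) \<Rightarrow> 'b \<Rightarrow> real" where
  "deg_ind G G' \<phi> x' = (\<Sum>y'\<in>\<phi> ` nodes G. w_ind G G' \<phi> x' y')"

definition edge_preserving :: "'a wgraph \<Rightarrow> 'b wgraph \<Rightarrow> ('a \<Rightarrow> 'b) \<Rightarrow> bool" where
  "edge_preserving G G' \<phi> \<longleftrightarrow> (\<forall>x y. adj G x y \<longrightarrow> adj G' (\<phi> x) (\<phi> y))"

text \<open>
  The induced subgraph is meaningful as a graph only if \<open>\<phi>\<close> is edge preserving; otherwise \<open>deg_ind\<close> may
  vanish at some nodes.
\<close>

definition induced_subgraph :: "'a wgraph \<Rightarrow> 'b wgraph \<Rightarrow> ('a \<Rightarrow> 'b) \<Rightarrow> 'b wgraph" where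
  "induced_subgraph G G' \<phi> =
     \<lparr>nodes = \<phi> ` nodes G, weight = w_ind G G' \<phi>, vmeasure = deg_ind G G' \<phi>\<rparr>"

definition embeds :: "'a wgraph \<Rightarrow> 'b wgraph \<Rightarrow> ('a \<Rightarrow> 'b) \<Rightarrow> bool" where
  "embeds G G' \<phi> \<longleftrightarrow>
     edge_preserving G G' \<phi> \<and>
     (\<forall>u :: 'a \<Rightarrow> real. \<forall>x\<in>nodes G.
        laplacian G u x =
        laplacian (induced_subgraph G G' \<phi>) (u \<circ> inv_into (nodes G) \<phi>) (\<phi> x))"

text \<open>
  Since division by zero is total in HOL, the requirement that the denominators be nonzero is stated
  explicitly in the two conditions below.
\<close>

definition degree_ratio_condition :: "'a wgraph \<Rightarrow> 'b wgraph \<Rightarrow> ('a \<Rightarrow> 'b) \<Rightarrow> bool" where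
  "degree_ratio_condition G G' \<phi> \<longleftrightarrow>
     (\<forall>xi\<in>nodes G. \<forall>xj\<in>nodes G.
        degree G xi \<noteq> 0 \<and> deg_ind G G' \<phi> (\<phi> xi) \<noteq> 0 \<and>
        weight G xi xj / degree G xi = w_ind G G' \<phi> (\<phi> xi) (\<phi> xj) / deg_ind G G' \<phi> (\<phi> xi))"

definition weight_ratio_condition :: "'a wgraph \<Rightarrow> 'b wgraph \<Rightarrow> ('a \<Rightarrow> 'b) \<Rightarrow> bool" where
  "weight_ratio_condition G G' \<phi> \<longleftrightarrow>
     (\<forall>xi\<in>nodes G. \<forall>xj\<in>nodes G. \<forall>xk\<in>nodes G. adj G xj xi \<longrightarrow> adj G xk xi \<longrightarrow>
        weight G xi xk \<noteq> 0 \<and> weight G' (\<phi> xi) (\<phi> xk) \<noteq> 0 \<and>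
        weight G xi xj / weight G xi xk =
        weight G' (\<phi> xi) (\<phi> xj) / weight G' (\<phi> xi) (\<phi> xk))"

end

theory Submission
  imports Defs
begin

text \<open>
  A Laplacian at \<open>x\<close> is the sum over \<open>y\<close> of the transition probability from \<open>x\<close> to \<open>y\<close> times
  \<open>u x - u y\<close>, so testing on indicator functions shows that it determines the off-diagonal transition
  probabilities; those on the diagonal vanish. Moreover, since probabilities at \<open>x\<close> add up to 1, they are
  determined by the ratios of the edge weights at \<open>x\<close>: fixing a neighbour \<open>z\<close>, the weights of the two graphs
  at \<open>x\<close> are proportional with factor \<open>weight G x z / weight G' (\<phi> x) (\<phi> z)\<close>, and so are the degrees.
\<close>

text \<open>With at least two nodes, connectedness gives a path from \<open>x\<close> to a different
  node; its first step is an edge at \<open>x\<close>.\<close>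

lemma is_wgraph_has_neighbour:
  assumes "is_wgraph G" "x \<in> nodes G"
  obtains y where "adj G x y"
proof -
  have "nodes G \<noteq> {x}"
    using assms(1) by (auto simp: is_wgraph_def)
  then obtain z where z: "z \<in> nodes G" "z \<noteq> x"
    using assms(2) by blast
  then have "(adj G)\<^sup>*\<^sup>* x z"
    using assms by (auto simp: is_wgraph_def connected_wgraph_def)
  then show thesis
    using z(2) that by (cases rule: converse_rtranclpE) auto
qed

lemma adj_commute: "is_wgraph G \<Longrightarrow> adj G x y \<longleftrightarrow> adj G y x"
  by (auto simp: adj_def is_wgraph_def)

lemma not_adj_refl: "is_wgraph G \<Longrightarrow> \<not> adj G x x"
  by (auto simp: adj_def is_wgraph_def)

lemma weight_eq_0_iff_not_adj:
  assumes "is_wgraph G" "x \<in> nodes G" "y \<in> nodes G"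
  shows "weight G x y = 0 \<longleftrightarrow> \<not> adj G x y"
  using assms by (auto simp: adj_def is_wgraph_def order_less_le)

lemma degree_pos:
  assumes "is_wgraph G" "x \<in> nodes G"
  shows "degree G x > 0"
proof -
  obtain y where "adj G x y"
    using is_wgraph_has_neighbour[OF assms] .
  then show ?thesis
    using assms unfolding degree_def
    by (intro sum_pos2[of _ y]) (auto simp: adj_def is_wgraph_def)
qed

text \<open>For \<open>u\<close> the indicator function of \<open>y\<close>, only the summand at
  \<open>y\<close> survives, and it is minus the coefficient there. The case \<open>y = x\<close> is
  out of reach, because the coefficient at \<open>x\<close> is always multiplied by 0.\<close>

lemma sum_differences_eqD:
  fixes p q :: "'a \<Rightarrow> real"
  assumes "finite A" "y \<in> A" "y \<noteq> x"
    and eq: "\<And>u :: 'a \<Rightarrow> real. (\<Sum>z\<in>A. p z * (u x - u z)) = (\<Sum>z\<in>A. q z * (u x - u z))"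
  shows "p y = q y"
proof -
  have "(\<Sum>z\<in>A. r z * (of_bool (x = y) - of_bool (z = y))) = - r y" for r :: "'a \<Rightarrow> real"
  proof -
    have "(\<Sum>z\<in>A. r z * (of_bool (x = y) - of_bool (z = y))) = (\<Sum>z\<in>A. if z = y then - r z else 0)"
      using assms(3) by (intro sum.cong) auto
    also have "\<dots> = - r y"
      using assms(1,2) by simp
    finally show ?thesis .
  qed
  then show ?thesis
    using eq[of "\<lambda>z. of_bool (z = y)"] by simp
qed

lemma laplacian_normalized:
  assumes "normalized_wgraph G" "x \<in> nodes G"
  shows "laplacian G u x = (\<Sum>y\<in>nodes G. weight G x y / degree G x * (u x - u y))"
  using assms by (simp add: laplacian_def normalized_wgraph_def sum_distrib_left)

lemma w_ind_image:
  assumes "inj_on \<phi> (nodes G)" "x \<in> nodes G" "y \<in> nodes G"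
  shows "w_ind G G' \<phi> (\<phi> x) (\<phi> y) = (if adj G x y then weight G' (\<phi> x) (\<phi> y) else 0)"
  using assms by (simp add: w_ind_def)

lemma deg_ind_eq:
  assumes "inj_on \<phi> (nodes G)"
  shows "deg_ind G G' \<phi> x' = (\<Sum>y\<in>nodes G. w_ind G G' \<phi> x' (\<phi> y))"
  by (simp add: deg_ind_def sum.reindex[OF assms])

text \<open>Reindexing along \<open>\<phi>\<close> turns this Laplacian into a sum over the nodes of
  \<open>G\<close>, so that its coefficients can be compared with those of the Laplacian of
  \<open>G\<close>.\<close>

lemma laplacian_induced_subgraph:
  assumes "inj_on \<phi> (nodes G)" "x \<in> nodes G"
  shows "laplacian (induced_subgraph G G' \<phi>) (u \<circ> inv_into (nodes G) \<phi>) (\<phi> x) =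
    (\<Sum>y\<in>nodes G. w_ind G G' \<phi> (\<phi> x) (\<phi> y) / deg_ind G G' \<phi> (\<phi> x) * (u x - u y))"
  using assms
  by (simp add: laplacian_def induced_subgraph_def sum.reindex sum_distrib_left)

text \<open>Positivity is asked for only on the edges at \<open>x\<close>, so that the lemma serves
  both for edge preserving maps and under the weight ratio condition.\<close>

lemma deg_ind_pos:
  assumes "is_wgraph G" "inj_on \<phi> (nodes G)" "x \<in> nodes G"
    and pos: "\<And>y. adj G x y \<Longrightarrow> weight G' (\<phi> x) (\<phi> y) > 0"
  shows "deg_ind G G' \<phi> (\<phi> x) > 0"
proof -
  obtain y where y: "adj G x y"
    using is_wgraph_has_neighbour[OF assms(1,3)] .
  then have "y \<in> nodes G"
    by (simp add: adj_def)
  then show ?thesis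
    unfolding deg_ind_eq[OF assms(2)]
    using assms(1) y pos
    by (intro sum_pos2[of _ y]) (auto simp: w_ind_image assms(2,3) is_wgraph_def less_imp_le)
qed

lemma embeds_imp_degree_ratio_condition:
  assumes G: "normalized_wgraph G" and inj: "inj_on \<phi> (nodes G)" and emb: "embeds G G' \<phi>"
  shows "degree_ratio_condition G G' \<phi>"
  unfolding degree_ratio_condition_def
proof (intro ballI conjI)
  fix x y assume x: "x \<in> nodes G" and y: "y \<in> nodes G"
  have wg: "is_wgraph G"
    using G by (simp add: normalized_wgraph_def)
  show "degree G x \<noteq> 0"
    using degree_pos[OF wg x] by simp
  show "deg_ind G G' \<phi> (\<phi> x) \<noteq> 0"
    using deg_ind_pos[OF wg inj x, of G'] emb
    by (force simp: embeds_def edge_preserving_def adj_def)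
  show "weight G x y / degree G x = w_ind G G' \<phi> (\<phi> x) (\<phi> y) / deg_ind G G' \<phi> (\<phi> x)"
  proof (cases "y = x")
    \<comment> \<open>The Laplacians say nothing about the diagonal, but neither graph has loops, so
      both quotients are 0.\<close>
    case True
    then show ?thesis
      using wg x by (simp add: is_wgraph_def not_adj_refl w_ind_image[OF inj])
  next
    case False
    have "finite (nodes G)"
      using wg by (simp add: is_wgraph_def)
    then show ?thesis
      using y False
    proof (rule sum_differences_eqD)
      fix u :: "'a \<Rightarrow> real"
      show "(\<Sum>z\<in>nodes G. weight G x z / degree G x * (u x - u z)) =
        (\<Sum>z\<in>nodes G. w_ind G G' \<phi> (\<phi> x) (\<phi> z) / deg_ind G G' \<phi> (\<phi> x) * (u x - u z))"
        using emb x unfolding embeds_def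
        by (metis laplacian_normalized[OF G x] laplacian_induced_subgraph[OF inj x])
    qed
  qed
qed

text \<open>On an edge of \<open>G\<close> the left-hand quotient is positive, so the numerator on
  the right cannot vanish. This yields edge preservation as well as the nonzero denominators in the
  weight ratio condition.\<close>

lemma degree_ratio_condition_weight_nonzero:
  assumes "is_wgraph G" "inj_on \<phi> (nodes G)" "degree_ratio_condition G G' \<phi>" "adj G x y"
  shows "weight G' (\<phi> x) (\<phi> y) \<noteq> 0"
proof -
  have xy: "x \<in> nodes G" "y \<in> nodes G"
    using assms(4) by (auto simp: adj_def)
  then have "weight G x y / degree G x = w_ind G G' \<phi> (\<phi> x) (\<phi> y) / deg_ind G G' \<phi> (\<phi> x)"
    using assms(3) by (simp add: degree_ratio_condition_def)
  moreover have "weight G x y / degree G x > 0"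
    using assms(4) degree_pos[OF assms(1) xy(1)] by (simp add: adj_def)
  ultimately show ?thesis
    using assms(4) by (auto simp: w_ind_image[OF assms(2) xy])
qed

lemma degree_ratio_condition_imp_embeds:
  assumes G: "normalized_wgraph G" and G': "is_wgraph G'" and inj: "inj_on \<phi> (nodes G)"
    and sub: "\<phi> ` nodes G \<subseteq> nodes G'" and ratio: "degree_ratio_condition G G' \<phi>"
  shows "embeds G G' \<phi>"
  unfolding embeds_def
proof (intro conjI allI ballI)
  have wg: "is_wgraph G"
    using G by (simp add: normalized_wgraph_def)
  show "edge_preserving G G' \<phi>"
    unfolding edge_preserving_def
  proof (intro allI impI)
    fix x y assume xy: "adj G x y"
    then have "\<phi> x \<in> nodes G'" "\<phi> y \<in> nodes G'"
      using sub by (auto simp: adj_def)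
    \<comment> \<open>Weights of \<open>G'\<close> are nonnegative, so a nonzero one makes an
      edge.\<close>
    then show "adj G' (\<phi> x) (\<phi> y)"
      using degree_ratio_condition_weight_nonzero[OF wg inj ratio xy]
      by (simp add: weight_eq_0_iff_not_adj[OF G'])
  qed
next
  fix u :: "'a \<Rightarrow> real" and x assume x: "x \<in> nodes G"
  show "laplacian G u x =
    laplacian (induced_subgraph G G' \<phi>) (u \<circ> inv_into (nodes G) \<phi>) (\<phi> x)"
    unfolding laplacian_normalized[OF G x] laplacian_induced_subgraph[OF inj x]
    using ratio x by (intro sum.cong) (simp_all add: degree_ratio_condition_def)
qed

text \<open>Dividing the degree ratio equations for two neighbours of the same node cancels both
  degrees.\<close>

lemma degree_ratio_condition_imp_weight_ratio_condition:
  assumes wg: "is_wgraph G" and inj: "inj_on \<phi> (nodes G)"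
    and ratio: "degree_ratio_condition G G' \<phi>"
  shows "weight_ratio_condition G G' \<phi>"
  unfolding weight_ratio_condition_def
proof (intro ballI impI conjI)
  fix x y z
  assume x: "x \<in> nodes G" and y: "y \<in> nodes G" and z: "z \<in> nodes G"
    and "adj G y x" and "adj G z x"
  then have xy: "adj G x y" and xz: "adj G x z"
    by (simp_all add: adj_commute[OF wg])
  let ?d = "degree G x" and ?e = "deg_ind G G' \<phi> (\<phi> x)"
  have d: "?d \<noteq> 0" and e: "?e \<noteq> 0"
    and ry: "weight G x y / ?d = weight G' (\<phi> x) (\<phi> y) / ?e"
    and rz: "weight G x z / ?d = weight G' (\<phi> x) (\<phi> z) / ?e"
    using ratio x y z xy xz by (auto simp: degree_ratio_condition_def w_ind_image[OF inj])
  show "weight G x z \<noteq> 0"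
    using xz by (simp add: adj_def)
  show "weight G' (\<phi> x) (\<phi> z) \<noteq> 0"
    using degree_ratio_condition_weight_nonzero[OF wg inj ratio xz] .
  have "weight G x y / weight G x z = (weight G x y / ?d) / (weight G x z / ?d)"
    using d by simp
  also have "\<dots> = weight G' (\<phi> x) (\<phi> y) / weight G' (\<phi> x) (\<phi> z)"
    unfolding ry rz using e by simp
  finally show "weight G x y / weight G x z = weight G' (\<phi> x) (\<phi> y) / weight G' (\<phi> x) (\<phi> z)" .
qed

lemma weight_ratio_condition_imp_degree_ratio_condition:
  assumes wg: "is_wgraph G" and wg': "is_wgraph G'" and inj: "inj_on \<phi> (nodes G)"
    and sub: "\<phi> ` nodes G \<subseteq> nodes G'" and ratio: "weight_ratio_condition G G' \<phi>"
  shows "degree_ratio_condition G G' \<phi>"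
  unfolding degree_ratio_condition_def
proof (intro ballI conjI)
  fix x y assume x: "x \<in> nodes G" and y: "y \<in> nodes G"
  have ratio_at: "weight G' (\<phi> x) (\<phi> b) \<noteq> 0"
      "weight G x a / weight G x b = weight G' (\<phi> x) (\<phi> a) / weight G' (\<phi> x) (\<phi> b)"
    if ab: "adj G x a" "adj G x b" for a b
  proof -
    have "a \<in> nodes G" "b \<in> nodes G" "adj G a x" "adj G b x"
      using ab adj_commute[OF wg, of x] by (simp_all add: adj_def)
    then show "weight G' (\<phi> x) (\<phi> b) \<noteq> 0"
      "weight G x a / weight G x b = weight G' (\<phi> x) (\<phi> a) / weight G' (\<phi> x) (\<phi> b)"
      using ratio x unfolding weight_ratio_condition_def by blast+
  qed
  have "weight G' (\<phi> x) (\<phi> b) > 0" if "adj G x b" for b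
  proof -
    have "\<phi> x \<in> nodes G'" "\<phi> b \<in> nodes G'"
      using that sub by (auto simp: adj_def)
    \<comment> \<open>With \<open>b\<close> in both positions the ratio equation is trivial; what
      counts is the requirement that its denominator be nonzero.\<close>
    then show ?thesis
      using ratio_at(1)[OF that that] wg' by (simp add: weight_eq_0_iff_not_adj adj_def)
  qed
  then show e: "deg_ind G G' \<phi> (\<phi> x) \<noteq> 0"
    using deg_ind_pos[OF wg inj x] by force
  show "degree G x \<noteq> 0"
    using degree_pos[OF wg x] by simp
  obtain z where z: "adj G x z"
    using is_wgraph_has_neighbour[OF wg x] .
  define c where "c = weight G x z / weight G' (\<phi> x) (\<phi> z)"
  have c: "c \<noteq> 0"
    using z ratio_at(1)[OF z z] by (simp add: c_def adj_def)
  have proportional: "weight G x a = c * w_ind G G' \<phi> (\<phi> x) (\<phi> a)" if a: "a \<in> nodes G" for a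
  proof (cases "adj G x a")
    case True
    have "weight G x z \<noteq> 0"
      using z by (simp add: adj_def)
    then show ?thesis
      using ratio_at[OF True z] True by (simp add: c_def w_ind_image[OF inj x a] field_simps)
  next
    \<comment> \<open>Off the edges of \<open>G\<close> both sides are 0: \<open>w_ind\<close>
      discards any edge of \<open>G'\<close> that does not come from an edge of
      \<open>G\<close>.\<close>
    case False
    then show ?thesis
      by (simp add: w_ind_image[OF inj x a] weight_eq_0_iff_not_adj[OF wg x a])
  qed
  have "degree G x = c * deg_ind G G' \<phi> (\<phi> x)"
    unfolding degree_def deg_ind_eq[OF inj] sum_distrib_left by (intro sum.cong refl proportional)
  \<comment> \<open>Numerator and denominator carry the same nonzero factor \<open>c\<close>, which
    cancels.\<close>
  then show "weight G x y / degree G x = w_ind G G' \<phi> (\<phi> x) (\<phi> y) / deg_ind G G' \<phi> (\<phi> x)"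
    using c by (simp add: proportional[OF y])
qed

theorem theorem4p7:
  fixes G :: "'a wgraph" and G' :: "'b wgraph" and \<phi> :: "'a \<Rightarrow> 'b"
  assumes "normalized_wgraph G"
    and "normalized_wgraph G'"
    and "bij_betw \<phi> (nodes G) (\<phi> ` nodes G)"
    and "\<phi> ` nodes G \<subseteq> nodes G'"
  shows "(embeds G G' \<phi> \<longleftrightarrow> degree_ratio_condition G G' \<phi>) \<and>
         (degree_ratio_condition G G' \<phi> \<longleftrightarrow> weight_ratio_condition G G' \<phi>)"
proof -
  have wg: "is_wgraph G" "is_wgraph G'" and inj: "inj_on \<phi> (nodes G)"
    using assms by (simp_all add: normalized_wgraph_def bij_betw_def)
  show ?thesis
    using embeds_imp_degree_ratio_condition[OF assms(1) inj]
      degree_ratio_condition_imp_embeds[OF assms(1) wg(2) inj assms(4)]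
      degree_ratio_condition_imp_weight_ratio_condition[OF wg(1) inj]
      weight_ratio_condition_imp_degree_ratio_condition[OF wg inj assms(4)]
    by blast
qed

end
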